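(* Under the hypotheses of the setting below ($f$ continuous satisfying Assumption 1 on $R\times I$ with $R=[-1,1]^n$, unique implicit function $g:R\to I$ whose power series at $0$ converges on $[-1-\delta,1+\delta]^n$ for some $\delta>0$), for each $N\ge1$ define $$\tilde g_N(x)=\sum_{0\le\beta\le N-1}\tilde c_\beta x^\beta,\qquad \tilde c_\beta=\prod_{k=1}^n(\beta_k+1)\sum_{1\le\alpha\le N}\prod_{k=1}^n\big(V_N^{-1}\big)_{\beta_k+1,\alpha_k}\,d_\alpha .$$ Then $\tilde g_N\to g$ weak-star in $L^\infty(R)$ as $N\to\infty$.
   Context: Multi-index notation: $\alpha\le\beta$ componentwise, $x^\beta=\prod_kx_k^{\beta_k}$, an integer $N$ used as a multi-index means $(N,\dots,N)$. $\operatorname{sign}_y f(x,y)=1$ if $f(x,y)\ge0$ and $-1$ otherwise; $\Theta_y f(x,y)=1$ if $f(x,y)\ge0$ and $0$ otherwise. Assumption 1 on $R\times I$: for every $x\in R$, $y\mapsto\operatorname{sign}_y f(x,y)$ has exactly one jump discontinuity on $I$. $n_y(f)\in\{1,-1\}$ is $1$ if $y\mapsto\operatorname{sign}_y f(x,y)$ is increasing on $I$ and $-1$ if decreasing (constant on $R$). $\Delta=2/N$; $R_\alpha=\prod_{k=1}^n[-1+(\alpha_k-1)\Delta,-1+\alpha_k\Delta]$; $V_N$ is the $N\times N$ matrix with entry in row $i$, column $j$ equal to $(-1+i\Delta)^j-(-1+(i-1)\Delta)^j$; $d_\alpha=\frac{1+n_y(f)}{2}|R_\alpha|\max I+\frac{1-n_y(f)}{2}|R_\alpha|\min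 I-n_y(f)\iint_{R_\alpha\times I}\Theta_y f\,dx\,dy$. *)

theory Defs
  imports "HOL-Analysis.Analysis"
begin

definition sgnp :: "real \<Rightarrow> real" where
  "sgnp t = (if t \<ge> 0 then 1 else -1)"

definition heav :: "real \<Rightarrow> real" where
  "heav t = (if t \<ge> 0 then 1 else 0)"

definition cube :: "real \<Rightarrow> (real^'n) set" where
  "cube r = {x. \<forall>k. - r \<le> x $ k \<and> x $ k \<le> r}"

definition assumption1 :: "(real^'n \<Rightarrow> real \<Rightarrow> real) \<Rightarrow> real set \<Rightarrow> bool" where
  "assumption1 f I = (\<forall>x\<in>cube 1. \<exists>!y. y \<in> I \<and>
      \<not> continuous (at y within I) (\<lambda>t. sgnp (f x t)))"

definition monom :: "('n::finite \<Rightarrow> nat) \<Rightarrow> real^'n \<Rightarrow> real" where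
  "monom \<beta> x = (\<Prod>k\<in>UNIV. (x $ k) ^ \<beta> k)"

definition Dlt :: "nat \<Rightarrow> real" where
  "Dlt N = 2 / real N"

definition Rcell :: "nat \<Rightarrow> ('n \<Rightarrow> nat) \<Rightarrow> (real^'n) set" where
  "Rcell N \<alpha> = {x. \<forall>k. -1 + (real (\<alpha> k) - 1) * Dlt N \<le> x $ k \<and> x $ k \<le> -1 + real (\<alpha> k) * Dlt N}"

definition Vmat :: "nat \<Rightarrow> nat \<Rightarrow> nat \<Rightarrow> real" where
  "Vmat N i j = (if i \<in> {1..N} \<and> j \<in> {1..N}
     then (-1 + real i * Dlt N) ^ j - (-1 + (real i - 1) * Dlt N) ^ j else 0)"

definition Vinv :: "nat \<Rightarrow> nat \<Rightarrow> nat \<Rightarrow> real" where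
  "Vinv N = (THE B. (\<forall>i j. (i \<notin> {1..N} \<or> j \<notin> {1..N}) \<longrightarrow> B i j = 0) \<and>
      (\<forall>i\<in>{1..N}. \<forall>j\<in>{1..N}.
         (\<Sum>k=1..N. B i k * Vmat N k j) = (if i = j then 1 else 0) \<and>
         (\<Sum>k=1..N. Vmat N i k * B k j) = (if i = j then 1 else 0)))"

text \<open>d_alpha, with I = {a..b} (so max I = b, min I = a) and ny = n_y(f).\<close>
definition dcoef :: "(real^'n::finite \<Rightarrow> real \<Rightarrow> real) \<Rightarrow> real \<Rightarrow> real \<Rightarrow> real
      \<Rightarrow> nat \<Rightarrow> ('n \<Rightarrow> nat) \<Rightarrow> real" where
  "dcoef f a b ny N \<alpha> =
     (1 + ny) / 2 * measure lborel (Rcell N \<alpha>) * b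
   + (1 - ny) / 2 * measure lborel (Rcell N \<alpha>) * a
   - ny * (\<integral>z\<in>Rcell N \<alpha> \<times> {a..b}. heav (f (fst z) (snd z)) \<partial>lborel)"

definition ctil :: "(real^'n::finite \<Rightarrow> real \<Rightarrow> real) \<Rightarrow> real \<Rightarrow> real \<Rightarrow> real
      \<Rightarrow> nat \<Rightarrow> ('n \<Rightarrow> nat) \<Rightarrow> real" where
  "ctil f a b ny N \<beta> =
     (\<Prod>k\<in>UNIV. real (\<beta> k + 1)) *
     (\<Sum>\<alpha>\<in>{\<alpha>. \<forall>k. 1 \<le> \<alpha> k \<and> \<alpha> k \<le> N}.
        (\<Prod>k\<in>UNIV. Vinv N (\<beta> k + 1) (\<alpha> k)) * dcoef f a b ny N \<alpha>)"

definition gtil :: "(real^'n::finite \<Rightarrow> real \<Rightarrow> real) \<Rightarrow> real \<Rightarrow> real \<Rightarrow> real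
      \<Rightarrow> nat \<Rightarrow> real^'n \<Rightarrow> real" where
  "gtil f a b ny N x = (\<Sum>\<beta>\<in>{\<beta>. \<forall>k. \<beta> k \<le> N - 1}. ctil f a b ny N \<beta> * monom \<beta> x)"

end

theory Submission
  imports Defs
begin

text \<open>
  The sign hypotheses make \<open>d\<^sub>\<alpha>\<close> the integral of \<open>g\<close> over \<open>R\<^sub>\<alpha>\<close>, so \<open>g\<^sub>N\<close> is the polynomial of degree
  \<open>< N\<close> in each variable with the same cell integrals as \<open>g\<close>. This operation is linear and a tensor
  product: it sends \<open>x\<^sup>\<gamma>\<close> to the product of the one-dimensional images of \<open>t\<^bsup>m\<^esup>\<close>, \<open>m = \<gamma>\<^sub>k\<close>, and the
  image of \<open>t\<^bsup>m\<^esup>\<close> is \<open>P' / (m + 1)\<close>, where \<open>P\<close> interpolates \<open>t\<^bsup>M\<^esup>\<close>, \<open>M = m + 1\<close>, at the \<open>N + 1\<close> equispaced nodes.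
  It equals \<open>t\<^bsup>m\<^esup>\<close> if \<open>m < N\<close>. Otherwise write \<open>t\<^bsup>M\<^esup> = \<omega> q + P\<close> with the nodal polynomial \<open>\<omega>\<close>. As the nodes
  are symmetric, the division can be done by factors \<open>t\<^sup>2 - s\<^sup>2\<close> with \<open>\<bar>s\<bar> \<le> 1\<close>, whence \<open>q\<close> has nonnegative
  coefficients and \<open>P(R) \<ge> 0\<close> for \<open>R > 1\<close>. Hence \<open>q(1) \<le> q(R) \<le> R\<^bsup>M\<^esup> / \<omega>(R)\<close>, and since \<open>\<omega>\<close> and \<open>\<omega>' / N\<close> on
  \<open>[-1, 1]\<close> are of size at most \<open>\<omega>(R)\<close> up to a constant, the image of \<open>t\<^bsup>m\<^esup>\<close> is at most \<open>C R\<^bsup>m\<^esup>\<close> on \<open>[-1, 1]\<close>,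
  uniformly in \<open>N\<close>. With \<open>R = 1 + \<delta>\<close> the power series of \<open>g\<close> dominates, so \<open>g\<^sub>N \<rightarrow> g\<close> boundedly and
  pointwise on the cube, which implies weak-star convergence.
\<close>

subsection \<open>Division by symmetric nodal polynomials\<close>

text \<open>Induction on \<open>N\<close>: an end point \<open>0\<close> or \<open>N + 1\<close> is
  split off so that \<open>u\<close> stays in the hull of the remaining points, and its distance
  from \<open>u\<close> is at most \<open>N + 1\<close>. For \<open>u <= N\<close> this is the top
  point, unless it is the omitted one; for \<open>1 <= u\<close> the mirrored argument applies after
  a shift by one.\<close>

lemma prod_dist_nat_le_fact:
  fixes u :: real
  assumes "0 \<le> u" "u \<le> real N" "i \<le> N"
  shows "(\<Prod>l\<in>{..N} - {i}. \<bar>u - real l\<bar>) \<le> fact N"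
  using assms
proof (induction N arbitrary: u i)
  case 0
  then show ?case by simp
next
  case (Suc N)
  have top: "(\<Prod>l\<in>{..Suc N} - {i}. \<bar>u - real l\<bar>) \<le> fact (Suc N)" if u: "u \<le> real N"
  proof (cases "i = Suc N")
    case True
    have "{..Suc N} - {i} = insert 0 ({..N} - {0})" using True by auto
    then have "(\<Prod>l\<in>{..Suc N} - {i}. \<bar>u - real l\<bar>) = u * (\<Prod>l\<in>{..N} - {0}. \<bar>u - real l\<bar>)"
      using Suc.prems by (subst \<open>{..Suc N} - {i} = _\<close>, subst prod.insert) auto
    also have "\<dots> \<le> real (Suc N) * fact N"
      using Suc.prems u by (intro mult_mono Suc.IH prod_nonneg) auto
    finally show ?thesis by simp
  next
    case False
    have "{..Suc N} - {i} = insert (Suc N) ({..N} - {i})" using False by auto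
    then have "(\<Prod>l\<in>{..Suc N} - {i}. \<bar>u - real l\<bar>) = \<bar>u - real (Suc N)\<bar> * (\<Prod>l\<in>{..N} - {i}. \<bar>u - real l\<bar>)"
      by simp
    also have "\<dots> \<le> real (Suc N) * fact N"
      using Suc.prems u False by (intro mult_mono Suc.IH prod_nonneg) auto
    finally show ?thesis by simp
  qed
  have bottom: "(\<Prod>l\<in>{..Suc N} - {i}. \<bar>u - real l\<bar>) \<le> fact (Suc N)" if u: "1 \<le> u"
  proof -
    have shift: "(\<Prod>l\<in>Suc ` ({..N} - {j}). \<bar>u - real l\<bar>) = (\<Prod>l\<in>{..N} - {j}. \<bar>(u - 1) - real l\<bar>)" for j
      by (subst prod.reindex) (auto simp: algebra_simps)
    show ?thesis
    proof (cases "i = 0")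
      case True
      have "{..Suc N} - {i} = insert (Suc N) (Suc ` ({..N} - {N}))"
      proof -
        have "{..Suc N} - {i} = Suc ` {..N}"
          unfolding True atMost_Suc_eq_insert_0 by auto
        also have "\<dots> = Suc ` (insert N ({..N} - {N}))" by (rule arg_cong[where f = "image Suc"]) auto
        finally show ?thesis by (simp only: image_insert)
      qed
      then have "(\<Prod>l\<in>{..Suc N} - {i}. \<bar>u - real l\<bar>) = \<bar>u - real (Suc N)\<bar> * (\<Prod>l\<in>{..N} - {N}. \<bar>(u - 1) - real l\<bar>)"
        using shift[of N] by (subst \<open>{..Suc N} - {i} = _\<close>, subst prod.insert) auto
      also have "\<dots> \<le> real (Suc N) * fact N"
        using Suc.prems u by (intro mult_mono Suc.IH prod_nonneg) auto
      finally show ?thesis by simp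
    next
      case False
      then obtain j where j: "i = Suc j" using not0_implies_Suc by blast
      have "{..Suc N} - {i} = insert 0 (Suc ` ({..N} - {j}))"
        unfolding j atMost_Suc_eq_insert_0 by auto
      then have "(\<Prod>l\<in>{..Suc N} - {i}. \<bar>u - real l\<bar>) = u * (\<Prod>l\<in>{..N} - {j}. \<bar>(u - 1) - real l\<bar>)"
        using shift[of j] Suc.prems by (subst \<open>{..Suc N} - {i} = _\<close>, subst prod.insert) auto
      also have "\<dots> \<le> real (Suc N) * fact N"
        using Suc.prems u j by (intro mult_mono Suc.IH prod_nonneg) auto
      finally show ?thesis by simp
    qed
  qed
  \<comment> \<open>For \<open>N = 0\<close> the ranges of \<open>top\<close> and
    \<open>bottom\<close> leave out the open unit interval, so the single remaining factor is
    bounded directly; for larger \<open>N\<close> they overlap.\<close>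
  show ?case
  proof (cases "N = 0")
    case True
    then have i: "i = 0 \<or> i = 1" and u: "u \<le> 1" using Suc.prems by auto
    have "{..Suc N} - {i} = {1 - i}" using i unfolding True by auto
    then have "(\<Prod>l\<in>{..Suc N} - {i}. \<bar>u - real l\<bar>) = \<bar>u - real (1 - i)\<bar>" by simp
    also have "\<dots> \<le> 1" using i Suc.prems(1) u by auto
    finally show ?thesis unfolding True by simp
  next
    case False
    then have "u \<le> real N \<or> 1 \<le> u" by linarith
    then show ?thesis using top bottom by blast
  qed
qed

definition nonneg_coeffs :: "real poly \<Rightarrow> bool" where
  "nonneg_coeffs p \<longleftrightarrow> (\<forall>i. 0 \<le> coeff p i)"

lemma nonneg_coeffs_pCons [simp]:
  "nonneg_coeffs (pCons c p) \<longleftrightarrow> 0 \<le> c \<and> nonneg_coeffs p"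
  unfolding nonneg_coeffs_def
  by (metis coeff_pCons_0 coeff_pCons_Suc old.nat.exhaust)

lemma nonneg_coeffs_0 [simp]: "nonneg_coeffs 0"
  by (simp add: nonneg_coeffs_def)

lemma nonneg_coeffs_poly_nonneg: "nonneg_coeffs p \<Longrightarrow> 0 \<le> x \<Longrightarrow> 0 \<le> poly p x"
  by (induction p) auto

lemma nonneg_coeffs_pderiv: "nonneg_coeffs p \<Longrightarrow> nonneg_coeffs (pderiv p)"
  by (simp add: nonneg_coeffs_def coeff_pderiv)

lemma nonneg_coeffs_mono:
  assumes "nonneg_coeffs p" "\<bar>x\<bar> \<le> y"
  shows "\<bar>poly p x\<bar> \<le> poly p y"
  using assms(1)
proof (induction p)
  case (pCons c p)
  have "\<bar>poly (pCons c p) x\<bar> \<le> \<bar>c\<bar> + \<bar>x\<bar> * \<bar>poly p x\<bar>"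
    by (metis abs_mult abs_triangle_ineq poly_pCons)
  also have "\<dots> \<le> c + y * poly p y"
    using pCons assms(2) by (intro add_mono mult_mono) auto
  finally show ?case by simp
qed auto

text \<open>At 1 the derivative weighs each coefficient by its index, which is at most
  \<open>degree p\<close>, and nonnegativity excludes cancellation.\<close>

lemma pderiv_at_1_le:
  assumes "nonneg_coeffs p"
  shows "poly (pderiv p) 1 \<le> real (degree p) * poly p 1"
  using assms
proof (induction p)
  case (pCons c p)
  show ?case
  proof (cases "p = 0")
    case False
    have "poly (pderiv (pCons c p)) 1 = poly p 1 + poly (pderiv p) 1"
      by (simp add: pderiv_pCons)
    also have "\<dots> \<le> poly p 1 + real (degree p) * poly p 1"
      using pCons by simp
    also have "\<dots> = real (Suc (degree p)) * poly p 1"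
      by (simp add: algebra_simps)
    also have "\<dots> \<le> real (Suc (degree p)) * (c + poly p 1)"
      using pCons by (intro mult_left_mono) auto
    finally show ?thesis using False by simp
  qed (simp add: pderiv_pCons)
qed simp

text \<open>Reduction modulo \<open>t^2 - s^2\<close> replaces \<open>t^2\<close> by
  \<open>s^2 >= 0\<close>, so no negative number ever enters. A single factor \<open>t - s\<close>
  with \<open>s < 0\<close> would spoil the signs, hence the pairing of \<open>s\<close> with
  \<open>-s\<close>.\<close>

lemma div_symmetric_pair:
  assumes "nonneg_coeffs p"
  shows "\<exists>q r. p = [:- (s\<^sup>2), 0, 1:] * q + r \<and> nonneg_coeffs q \<and> nonneg_coeffs r
           \<and> (r = 0 \<or> degree r < 2)"
  using assms
proof (induction p)
  case 0
  show ?case by (intro exI[of _ 0]) auto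
next
  case (pCons c p)
  from pCons obtain q r where p: "p = [:- (s\<^sup>2), 0, 1:] * q + r"
    and q: "nonneg_coeffs q" and r: "nonneg_coeffs r" "r = 0 \<or> degree r < 2"
    by auto
  have "degree r \<le> 1" using r by auto
  then have "r = [:coeff r 0, coeff r 1:]"
    by (intro poly_eqI) (auto simp: coeff_pCons coeff_eq_0 split: nat.split)
  then obtain u v where uv: "r = [:u, v:]" by blast
  \<comment> \<open>Multiplying the old remainder by \<open>t\<close> gives
    \<open>u t + v t^2\<close>, and \<open>v t^2 = v (t^2 - s^2) + s^2 v\<close>.\<close>
  have "pCons c p = [:- (s\<^sup>2), 0, 1:] * pCons v q + [:c + s\<^sup>2 * v, u:]"
    unfolding p uv by (simp add: algebra_simps)
  then show ?case
    using q r pCons.prems unfolding uv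
    by (intro exI[of _ "pCons v q"] exI[of _ "[:c + s\<^sup>2 * v, u:]"]) auto
qed

definition nodal :: "real set \<Rightarrow> real poly" where
  "nodal S = (\<Prod>s\<in>S. [:- s, 1:])"

lemma poly_nodal: "poly (nodal S) x = (\<Prod>s\<in>S. x - s)"
  by (simp add: nodal_def poly_prod)

lemma degree_nodal [simp]: "degree (nodal S) = card S"
  unfolding nodal_def by (subst degree_prod_eq_sum_degree) auto

lemma nodal_nonzero [simp]: "nodal S \<noteq> 0"
  unfolding nodal_def by (cases "finite S") auto

text \<open>Two successive divisions combine to one by \<open>nodal S\<close> with remainder
  \<open>nodal T * r2 + r1\<close>; its value at \<open>R\<close> is nonnegative because the three
  values that form it are.\<close>

lemma nodal_div_step:
  assumes S: "finite S" "T \<subseteq> S" and T: "poly (nodal T) R \<ge> 0"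
    and r1: "0 \<le> poly r1 R" "r1 = 0 \<or> degree r1 < card T"
    and r2: "0 \<le> poly r2 R" "r2 = 0 \<or> degree r2 < card (S - T)"
    and p: "p = nodal T * p' + r1" "p' = nodal (S - T) * q + r2"
  shows "\<exists>r. p = nodal S * q + r \<and> 0 \<le> poly r R \<and> (r = 0 \<or> degree r < card S)"
proof (intro exI conjI)
  have "nodal S = nodal T * nodal (S - T)"
    unfolding nodal_def using S by (metis mult.commute prod.subset_diff)
  then show "p = nodal S * q + (nodal T * r2 + r1)"
    unfolding p by (simp only: distrib_left mult.assoc add.assoc)
  show "0 \<le> poly (nodal T * r2 + r1) R"
    using T r1 r2 by simp
  have card: "card S = card T + card (S - T)"
    using S by (metis card_Diff_subset card_mono finite_subset le_add_diff_inverse)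
  have "nodal T * r2 = 0 \<or> degree (nodal T * r2) < card S"
    using r2 card by (cases "r2 = 0") (auto simp: degree_mult_eq)
  moreover have "r1 = 0 \<or> degree r1 < card S"
    using r1 card by auto
  ultimately show "nodal T * r2 + r1 = 0 \<or> degree (nodal T * r2 + r1) < card S"
    using degree_add_less[of "nodal T * r2" "card S" r1]
    by (cases "nodal T * r2 = 0"; cases "r1 = 0") (simp_all del: mult_eq_0_iff)
qed

text \<open>The pairs \<open>s\<close>, \<open>-s\<close> are divided out one after another. The
  quotient keeps nonnegative coefficients; the composite remainder may lose them, since
  \<open>nodal T\<close> can have negative ones, so only its sign at \<open>R\<close> is carried
  through the induction.\<close>

lemma div_nodal_symmetric:
  assumes "finite S" "S \<subseteq> {-1..1}" "\<And>s. s \<in> S \<Longrightarrow> - s \<in> S" "nonneg_coeffs p" "1 \<le> R"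
  shows "\<exists>q. nonneg_coeffs q \<and>
           (\<exists>r. p = nodal S * q + r \<and> 0 \<le> poly r R \<and> (r = 0 \<or> degree r < card S))"
  using assms(1-4)
proof (induction S arbitrary: p rule: finite_psubset_induct)
  case (psubset S)
  show ?case
  proof (cases "S = {}")
    case True
    then show ?thesis
      using psubset.prems by (intro exI[of _ p]) (auto simp: nodal_def)
  next
    case False
    then obtain s where s: "s \<in> S" by blast
    \<comment> \<open>For \<open>s = 0\<close> this is a singleton, and the division by
      \<open>t\<close> just splits off the constant coefficient.\<close>
    define T where "T = {s, - s}"
    have T: "T \<subseteq> S" "S - T \<subset> S"
      using s psubset.prems(2) by (auto simp: T_def)
    have R: "- R \<le> s" "s \<le> R"
      using subsetD[OF psubset.prems(1) s] \<open>1 \<le> R\<close> by auto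
    have "\<exists>p' r. p = nodal T * p' + r \<and> nonneg_coeffs p' \<and> nonneg_coeffs r
            \<and> (r = 0 \<or> degree r < card T)"
    proof (cases "s = 0")
      case True
      then have "nodal T = [:0, 1:]" "card T = 1"
        by (auto simp: T_def nodal_def)
      moreover obtain c p' where "p = pCons c p'" by (rule pCons_cases)
      ultimately show ?thesis
        using psubset.prems(3) by (intro exI[of _ p'] exI[of _ "[:c:]"]) auto
    next
      case False
      then have "s \<noteq> - s" by simp
      then have "nodal T = [:- (s\<^sup>2), 0, 1:]" "card T = 2"
        by (auto simp: T_def nodal_def power2_eq_square)
      then show ?thesis
        using div_symmetric_pair[OF psubset.prems(3), of s] by simp
    qed
    then obtain p' r1 where p': "p = nodal T * p' + r1" "nonneg_coeffs p'" "nonneg_coeffs r1"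
      "r1 = 0 \<or> degree r1 < card T"
      by blast
    have "\<exists>q. nonneg_coeffs q \<and> (\<exists>r. p' = nodal (S - T) * q + r \<and> 0 \<le> poly r R
        \<and> (r = 0 \<or> degree r < card (S - T)))"
    proof (rule psubset.IH[OF T(2)])
      show "S - T \<subseteq> {-1..1}" using psubset.prems(1) by blast
      show "- t \<in> S - T" if "t \<in> S - T" for t
        using that psubset.prems(2) by (auto simp: T_def)
    qed (fact p'(2))
    then obtain q r2 where q: "nonneg_coeffs q" "p' = nodal (S - T) * q + r2" "0 \<le> poly r2 R"
      "r2 = 0 \<or> degree r2 < card (S - T)"
      by blast
    have "0 \<le> poly (nodal T) R"
      unfolding poly_nodal by (rule prod_nonneg) (use R in \<open>auto simp: T_def\<close>)
    moreover have "0 \<le> poly r1 R"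
      using p' \<open>1 \<le> R\<close> by (intro nonneg_coeffs_poly_nonneg) auto
    ultimately show ?thesis
      using nodal_div_step[OF psubset.hyps T(1) _ _ p'(4) q(3,4) p'(1) q(2)] q(1) by blast
  qed
qed

subsection \<open>Interpolation of powers at equispaced nodes\<close>

definition node :: "nat \<Rightarrow> nat \<Rightarrow> real" where
  "node N i = -1 + real i * Dlt N"

abbreviation nodes :: "nat \<Rightarrow> real set" where
  "nodes N \<equiv> node N ` {..N}"

lemma Dlt_pos: "1 \<le> N \<Longrightarrow> 0 < Dlt N"
  by (simp add: Dlt_def)

lemma node_0 [simp]: "node N 0 = -1"
  by (simp add: node_def)

lemma node_N: "1 \<le> N \<Longrightarrow> node N N = 1"
  by (simp add: node_def Dlt_def)

lemma node_le_iff: "1 \<le> N \<Longrightarrow> node N i \<le> node N j \<longleftrightarrow> i \<le> j"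
  using Dlt_pos[of N] by (simp add: node_def)

lemma inj_node: "1 \<le> N \<Longrightarrow> inj (node N)"
  by (metis injI node_le_iff nle_le)

lemma card_nodes: "1 \<le> N \<Longrightarrow> card (nodes N) = Suc N"
  by (simp add: card_image inj_on_subset[OF inj_node])

lemma node_bounds: "1 \<le> N \<Longrightarrow> i \<le> N \<Longrightarrow> node N i \<in> {-1..1}"
  using node_le_iff[of N 0 i] node_le_iff[of N i N] node_N[of N] by simp

lemma minus_node: "1 \<le> N \<Longrightarrow> i \<le> N \<Longrightarrow> - node N i = node N (N - i)"
  by (simp add: node_def Dlt_def of_nat_diff field_simps)

lemma poly_nodal_nodes: "1 \<le> N \<Longrightarrow> poly (nodal (nodes N)) x = (\<Prod>i\<le>N. x - node N i)"
  unfolding poly_nodal by (subst prod.reindex) (auto intro: inj_on_subset[OF inj_node])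

text \<open>The affine map \<open>u = (x + 1) / Dlt N\<close> carries the nodes to
  \<open>0, ..., N\<close>; each of the \<open>N\<close> remaining factors contributes one
  \<open>Dlt N\<close>.\<close>

lemma prod_node_dist_le:
  assumes N: "1 \<le> N" and x: "\<bar>x\<bar> \<le> 1" and i: "i \<le> N"
  shows "\<bar>\<Prod>l\<in>{..N} - {i}. x - node N l\<bar> \<le> fact N * Dlt N ^ N"
proof -
  define u where "u = (x + 1) / Dlt N"
  have D: "0 < Dlt N" by (rule Dlt_pos[OF N])
  have "\<bar>\<Prod>l\<in>{..N} - {i}. x - node N l\<bar> = (\<Prod>l\<in>{..N} - {i}. Dlt N * \<bar>u - real l\<bar>)"
    unfolding abs_prod
  proof (intro prod.cong refl)
    fix l
    have "x - node N l = Dlt N * (u - real l)"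
      using D by (simp add: u_def node_def field_simps)
    then show "\<bar>x - node N l\<bar> = Dlt N * \<bar>u - real l\<bar>"
      using D by (simp add: abs_mult)
  qed
  also have "\<dots> = Dlt N ^ N * (\<Prod>l\<in>{..N} - {i}. \<bar>u - real l\<bar>)"
    using i by (simp add: prod.distrib)
  also have "\<dots> \<le> Dlt N ^ N * fact N"
  proof (intro mult_left_mono prod_dist_nat_le_fact i)
    show "0 \<le> u" using x D by (simp add: u_def)
    have "(x + 1) \<le> real N * Dlt N" using x N by (simp add: Dlt_def)
    then show "u \<le> real N" using D by (simp add: u_def field_simps)
  qed (use D in auto)
  finally show ?thesis by (simp add: mult.commute)
qed

lemma nodal_nodes_le:
  assumes N: "1 \<le> N" and x: "\<bar>x\<bar> \<le> 1"
  shows "\<bar>poly (nodal (nodes N)) x\<bar> \<le> 2 * (fact N * Dlt N ^ N)"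
proof -
  have "{..N} = insert 0 ({..N} - {0})" by auto
  then have "poly (nodal (nodes N)) x = (x - node N 0) * (\<Prod>l\<in>{..N} - {0}. x - node N l)"
    unfolding poly_nodal_nodes[OF N] by (subst \<open>{..N} = _\<close>, subst prod.insert) auto
  then have "\<bar>poly (nodal (nodes N)) x\<bar> = \<bar>x + 1\<bar> * \<bar>\<Prod>l\<in>{..N} - {0}. x - node N l\<bar>"
    by (simp add: abs_mult)
  also have "\<dots> \<le> 2 * (fact N * Dlt N ^ N)"
    using prod_node_dist_le[OF assms, of 0] x by (intro mult_mono) auto
  finally show ?thesis .
qed

text \<open>Each of the \<open>N + 1\<close> terms of the product rule omits one node, which is the
  product bounded in \<open>prod_node_dist_le\<close>.\<close>

lemma pderiv_nodal_nodes_le: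
  assumes N: "1 \<le> N" and x: "\<bar>x\<bar> \<le> 1"
  shows "\<bar>poly (pderiv (nodal (nodes N))) x\<bar> \<le> real (Suc N) * (fact N * Dlt N ^ N)"
proof -
  have "nodal (nodes N) = (\<Prod>i\<le>N. [:- node N i, 1:])"
    unfolding nodal_def by (subst prod.reindex) (auto intro: inj_on_subset[OF inj_node[OF N]])
  then have "poly (pderiv (nodal (nodes N))) x = (\<Sum>i\<le>N. \<Prod>l\<in>{..N} - {i}. x - node N l)"
    by (simp add: pderiv_prod poly_sum poly_prod pderiv_pCons)
  also have "\<bar>\<dots>\<bar> \<le> (\<Sum>i\<le>N. \<bar>\<Prod>l\<in>{..N} - {i}. x - node N l\<bar>)"
    by (rule sum_abs)
  also have "\<dots> \<le> (\<Sum>i\<le>N. fact N * Dlt N ^ N)"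
    by (intro sum_mono prod_node_dist_le assms) auto
  finally show ?thesis by simp
qed

text \<open>For \<open>i < N\<close> the factor \<open>R - node N i\<close> exceeds
  \<open>1 - node N i = (N - i) * Dlt N\<close>, and the last factor is \<open>R - 1\<close>. The
  scale \<open>fact N * Dlt N ^ N\<close> is the same as in the upper bounds on
  \<open>[-1, 1]\<close>, so it cancels and leaves constants free of \<open>N\<close>.\<close>

lemma nodal_nodes_ge:
  assumes N: "1 \<le> N" and R: "1 < R"
  shows "(R - 1) * (fact N * Dlt N ^ N) \<le> poly (nodal (nodes N)) R"
proof -
  have "fact N * Dlt N ^ N = (\<Prod>i<N. real (N - i) * Dlt N)"
    by (simp add: fact_prod_rev prod.distrib atLeast0LessThan)
  also have "\<dots> \<le> (\<Prod>i<N. R - node N i)"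
  proof (intro prod_mono conjI)
    fix i assume i: "i \<in> {..<N}"
    have "real (N - i) * Dlt N = 1 - node N i"
      using i N by (simp add: node_def Dlt_def of_nat_diff field_simps)
    then show "real (N - i) * Dlt N \<le> R - node N i" using R by simp
    show "0 \<le> real (N - i) * Dlt N" using Dlt_pos[OF N] by simp
  qed
  finally have "(R - 1) * (fact N * Dlt N ^ N) \<le> (R - node N N) * (\<Prod>i<N. R - node N i)"
    unfolding node_N[OF N] using R by (intro mult_left_mono) auto
  also have "\<dots> = poly (nodal (nodes N)) R"
    unfolding poly_nodal_nodes[OF N] by (simp flip: lessThan_Suc_atMost)
  finally show ?thesis .
qed

text \<open>The error is the derivative \<open>W q' + W' q\<close> of \<open>W q\<close>. With the
  scale \<open>F\<close> of the nodal polynomial the two terms are at most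
  \<open>2 F * M q(1)\<close> and \<open>M F * q(1)\<close>, whence the constant 3, and
  \<open>F q(1)\<close> is controlled by the value at \<open>R\<close>.\<close>

lemma power_interpolant_deriv_error:
  assumes N: "1 \<le> N" "N < M" and R: "1 < R" and x: "\<bar>x\<bar> \<le> 1"
    and P: "degree P \<le> N" "\<And>i. i \<le> N \<Longrightarrow> poly P (node N i) = node N i ^ M"
  shows "\<bar>real M * x ^ (M - 1) - poly (pderiv P) x\<bar> \<le> real M * (3 * R ^ M / (R - 1))"
proof -
  define p :: "real poly" where "p = Polynomial.monom 1 M"
  define W where "W = nodal (nodes N)"
  define F :: real where "F = fact N * Dlt N ^ N"
  have F: "0 < F" using Dlt_pos[OF N(1)] by (simp add: F_def)
  have "nonneg_coeffs p" by (simp add: p_def nonneg_coeffs_def)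
  moreover have "nodes N \<subseteq> {-1..1}" using node_bounds[OF N(1)] by blast
  moreover have "- s \<in> nodes N" if "s \<in> nodes N" for s
    using that minus_node[OF N(1)] by auto
  ultimately obtain q r where q: "nonneg_coeffs q" and p: "p = W * q + r"
    and r: "0 \<le> poly r R" "r = 0 \<or> degree r < Suc N"
    using div_nodal_symmetric[of "nodes N" p R] R card_nodes[OF N(1)] unfolding W_def by auto
  have W0: "poly W s = 0" if "s \<in> nodes N" for s
    using that unfolding W_def poly_nodal by auto
  \<comment> \<open>Both have degree at most \<open>N\<close> and agree with \<open>t^M\<close> at
    \<open>N + 1\<close> nodes.\<close>
  have "r = P"
  proof (rule poly_eqI_degree)
    fix s assume s: "s \<in> nodes N"
    have "poly p s = poly r s" unfolding p using W0[OF s] by simp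
    then show "poly r s = poly P s" using s P(2) by (auto simp: p_def poly_monom)
  qed (use card_nodes[OF N(1)] r P in auto)
  have "degree q \<le> M"
  proof (cases "q = 0")
    case False
    then have "degree q \<le> degree (W * q)" by (simp add: W_def degree_mult_eq)
    also have "\<dots> = degree (p - r)" unfolding p by simp
    also have "\<dots> \<le> M"
      using P N unfolding \<open>r = P\<close> p_def by (intro degree_diff_le) (auto simp: degree_monom_eq)
    finally show ?thesis .
  qed simp
  have q1: "0 \<le> poly q 1" by (rule nonneg_coeffs_poly_nonneg[OF q]) simp
  have qR: "poly q 1 \<le> poly q R" using nonneg_coeffs_mono[OF q, of 1 R] R by simp
  \<comment> \<open>The remainder is nonnegative at \<open>R\<close>, so dropping it from
    \<open>R^M = W(R) q(R) + r(R)\<close> bounds \<open>W(R) q(R)\<close>.\<close>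
  have "(R - 1) * F * poly q 1 \<le> poly W R * poly q R"
    using nodal_nodes_ge[OF N(1) R] qR q1 R F unfolding W_def F_def[symmetric]
    by (intro mult_mono) (auto intro: order_trans[rotated])
  also have "\<dots> \<le> poly p R" unfolding p using r by simp
  finally have key: "F * poly q 1 \<le> R ^ M / (R - 1)"
    using R by (simp add: p_def poly_monom field_simps)
  have "poly (pderiv q) 1 \<le> real (degree q) * poly q 1" by (rule pderiv_at_1_le[OF q])
  also have "\<dots> \<le> real M * poly q 1" using \<open>degree q \<le> M\<close> q1 by (intro mult_right_mono) auto
  finally have dq: "\<bar>poly (pderiv q) x\<bar> \<le> real M * poly q 1"
    using nonneg_coeffs_mono[OF nonneg_coeffs_pderiv[OF q] x] by simp
  have "poly (pderiv p) x = real M * x ^ (M - 1)"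
    by (simp add: p_def pderiv_monom poly_monom)
  moreover have "poly (pderiv p) x = poly W x * poly (pderiv q) x + poly (pderiv W) x * poly q x
      + poly (pderiv P) x"
    unfolding p \<open>r = P\<close> by (simp add: pderiv_add pderiv_mult algebra_simps)
  ultimately have "real M * x ^ (M - 1) - poly (pderiv P) x =
      poly W x * poly (pderiv q) x + poly (pderiv W) x * poly q x" by simp
  also have "\<bar>\<dots>\<bar> \<le> \<bar>poly W x\<bar> * \<bar>poly (pderiv q) x\<bar> + \<bar>poly (pderiv W) x\<bar> * \<bar>poly q x\<bar>"
    by (metis abs_mult abs_triangle_ineq)
  also have "\<dots> \<le> (2 * F) * (real M * poly q 1) + (real M * F) * poly q 1"
  proof (intro add_mono mult_mono)
    show "\<bar>poly W x\<bar> \<le> 2 * F" unfolding W_def F_def by (rule nodal_nodes_le[OF N(1) x])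
    have "\<bar>poly (pderiv W) x\<bar> \<le> real (Suc N) * F"
      unfolding W_def F_def by (rule pderiv_nodal_nodes_le[OF N(1) x])
    also have "\<dots> \<le> real M * F" using N F by (intro mult_right_mono) auto
    finally show "\<bar>poly (pderiv W) x\<bar> \<le> real M * F" .
    show "\<bar>poly q x\<bar> \<le> poly q 1" by (rule nonneg_coeffs_mono[OF q x])
  qed (use F dq in auto)
  also have "\<dots> = 3 * real M * (F * poly q 1)" by (simp add: algebra_simps)
  also have "\<dots> \<le> 3 * real M * (R ^ M / (R - 1))" using key by (intro mult_left_mono) auto
  finally show ?thesis by (simp add: mult_ac)
qed

section \<open>Interpolation and the inverse of the matrix \<open>Vmat\<close>\<close>

text \<open>Newton's construction: a multiple of \<open>nodal S\<close> corrects the value at the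
  new point and vanishes at the old ones.\<close>

lemma exists_interpolation:
  assumes "finite S"
  shows "\<exists>p. (p = 0 \<or> degree p < card S) \<and> (\<forall>s\<in>S. poly p s = (y s :: real))"
  using assms
proof (induction S)
  case (insert s S)
  then obtain p where p: "p = 0 \<or> degree p < card S" "\<forall>t\<in>S. poly p t = y t" by blast
  define c where "c = (y s - poly p s) / poly (nodal S) s"
  have nz: "poly (nodal S) s \<noteq> 0" using insert.hyps by (auto simp: poly_nodal)
  have "poly (p + smult c (nodal S)) t = y t" if "t \<in> insert s S" for t
  proof (cases "t = s")
    case False
    then have "t \<in> S" using that by simp
    then have "poly (nodal S) t = 0" using insert.hyps(1) by (auto simp: poly_nodal)
    then show ?thesis using p \<open>t \<in> S\<close> by simp
  qed (use nz in \<open>simp add: c_def\<close>)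
  moreover have "degree (p + smult c (nodal S)) < card (insert s S)"
    using p(1) insert.hyps by (intro degree_add_less) (auto simp: less_Suc_eq)
  ultimately show ?case by blast
qed auto

lemma Vmat_node:
  assumes "i \<in> {1..N}" "j \<in> {1..N}"
  shows "Vmat N i j = node N i ^ j - node N (i - 1) ^ j"
  using assms by (simp add: Vmat_def node_def of_nat_diff)

text \<open>This reads \<open>Vmat\<close> as the map from the coefficients of a polynomial to its
  increments over the cells. The term \<open>j = 0\<close> can be added freely, since constants have
  no increments.\<close>

lemma Vmat_mult_coeffs:
  assumes "i \<in> {1..N}" "degree p \<le> N"
  shows "(\<Sum>j=1..N. Vmat N i j * coeff p j) = poly p (node N i) - poly p (node N (i - 1))"
proof -
  have "(\<Sum>j=1..N. Vmat N i j * coeff p j)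
      = (\<Sum>j=1..N. coeff p j * (node N i ^ j - node N (i - 1) ^ j))"
    using assms by (intro sum.cong) (simp_all add: Vmat_node mult.commute)
  also have "\<dots> = (\<Sum>j\<le>N. coeff p j * (node N i ^ j - node N (i - 1) ^ j))"
    by (rule sum.mono_neutral_left) (auto simp: not_le)
  also have "\<dots> = poly p (node N i) - poly p (node N (i - 1))"
  proof -
    have "poly p x = (\<Sum>j\<le>N. coeff p j * x ^ j)" for x
      unfolding poly_altdef using assms(2)
      by (intro sum.mono_neutral_left) (auto simp: coeff_eq_0)
    then show ?thesis by (simp add: right_diff_distrib sum_subtractf)
  qed
  finally show ?thesis .
qed

text \<open>A kernel vector gives a polynomial without constant term that takes one value at all
  \<open>N + 1\<close> nodes; having degree at most \<open>N\<close>, it is constant, hence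
  zero.\<close>

lemma Vmat_inj:
  assumes N: "1 \<le> N" and 0: "\<And>i. i \<in> {1..N} \<Longrightarrow> (\<Sum>j=1..N. Vmat N i j * c j) = 0"
    and j: "j \<in> {1..N}"
  shows "c j = 0"
proof -
  define p where "p = (\<Sum>j=1..N. Polynomial.monom (c j) j)"
  have coeff: "coeff p k = (if k \<in> {1..N} then c k else 0)" for k
    by (simp add: p_def coeff_sum)
  have deg: "degree p \<le> N"
    by (rule degree_le) (simp add: coeff)
  have "poly p (node N i) = poly p (-1)" if "i \<le> N" for i
    using that
  proof (induction i)
    case (Suc i)
    have "(\<Sum>j=1..N. Vmat N (Suc i) j * coeff p j) = 0"
      using 0[of "Suc i"] Suc.prems by (simp add: coeff)
    then show ?case
      using Vmat_mult_coeffs[of "Suc i" N p] deg Suc by simp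
  qed simp
  then have "p = [:poly p (-1):]"
    using card_nodes[OF N] deg by (intro poly_eqI_degree[of "nodes N"]) auto
  then have "coeff p j = coeff [:poly p (-1):] j" by simp
  then show ?thesis using j coeff[of j] by (simp add: coeff_pCons split: nat.splits)
qed

lemma Vmat_right_inverse_exists:
  assumes N: "1 \<le> N"
  shows "\<exists>B. (\<forall>i j. (i \<notin> {1..N} \<or> j \<notin> {1..N}) \<longrightarrow> B i j = 0) \<and>
      (\<forall>i\<in>{1..N}. \<forall>j\<in>{1..N}. (\<Sum>k=1..N. Vmat N i k * B k j) = (if i = j then 1 else 0))"
proof -
  \<comment> \<open>Column \<open>j\<close> of the inverse holds the coefficients of the interpolant of the unit step at the \<open>j\<close>-th node;
    the constant coefficient is irrelevant, as only differences of values enter.\<close>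
  have "\<exists>p. degree p \<le> N \<and> (\<forall>s\<in>nodes N. poly p s = (if node N j \<le> s then 1 else 0))" for j
    using exists_interpolation[of "nodes N" "\<lambda>s. if node N j \<le> s then 1 else 0"] card_nodes[OF N]
    by (metis finite_atMost finite_imageI less_Suc_eq_le degree_0 zero_le)
  then obtain L where L: "\<And>j. degree (L j) \<le> N"
    "\<And>j s. s \<in> nodes N \<Longrightarrow> poly (L j) s = (if node N j \<le> s then 1 else 0)"
    by metis
  define B where "B k j = (if k \<in> {1..N} \<and> j \<in> {1..N} then coeff (L j) k else 0)" for k j
  have "(\<Sum>k=1..N. Vmat N i k * B k j) = (if i = j then 1 else 0)"
    if ij: "i \<in> {1..N}" "j \<in> {1..N}" for i j
  proof -
    have "(\<Sum>k=1..N. Vmat N i k * B k j) = (\<Sum>k=1..N. Vmat N i k * coeff (L j) k)"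
      using ij by (intro sum.cong) (auto simp: B_def)
    also have "\<dots> = poly (L j) (node N i) - poly (L j) (node N (i - 1))"
      by (rule Vmat_mult_coeffs[OF ij(1) L(1)])
    also have "\<dots> = (if j \<le> i then 1 else 0) - (if j \<le> i - 1 then 1 else 0)"
    proof -
      have "node N i \<in> nodes N" "node N (i - 1) \<in> nodes N" using ij by auto
      then show ?thesis using L(2) node_le_iff[OF N] by simp
    qed
    finally show ?thesis using ij by auto
  qed
  then show ?thesis by (intro exI[of _ B]) (auto simp: B_def)
qed

text \<open>The description in \<open>Vinv\<close> must be shown to have exactly one solution. A
  right inverse \<open>B\<close> exists; from \<open>V (B V - 1) = (V B) V - V = 0\<close> and
  injectivity it is also a left inverse, and injectivity again gives uniqueness. Vanishing outside
  the index range makes the solutions equal as functions.\<close>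

lemma Vmat_Vinv:
  assumes N: "1 \<le> N" and ij: "i \<in> {1..N}" "j \<in> {1..N}"
  shows "(\<Sum>k=1..N. Vmat N i k * Vinv N k j) = (if i = j then 1 else 0)"
proof -
  define inverse_of where "inverse_of B \<longleftrightarrow>
      (\<forall>i j. (i \<notin> {1..N} \<or> j \<notin> {1..N}) \<longrightarrow> B i j = 0) \<and>
      (\<forall>i\<in>{1..N}. \<forall>j\<in>{1..N}.
         (\<Sum>k=1..N. B i k * Vmat N k j) = (if i = j then 1 else 0) \<and>
         (\<Sum>k=1..N. Vmat N i k * B k j) = (if i = j then 1 else 0))" for B :: "nat \<Rightarrow> nat \<Rightarrow> real"
  obtain B where B0: "\<And>i j. (i \<notin> {1..N} \<or> j \<notin> {1..N}) \<Longrightarrow> B i j = 0"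
    and B: "\<And>i j. i \<in> {1..N} \<Longrightarrow> j \<in> {1..N} \<Longrightarrow> (\<Sum>k=1..N. Vmat N i k * B k j) = (if i = j then 1 else 0)"
    using Vmat_right_inverse_exists[OF N] by blast
  have BV: "(\<Sum>k=1..N. B i k * Vmat N k j) = (if i = j then 1 else 0)"
    if i: "i \<in> {1..N}" and j: "j \<in> {1..N}" for i j
  proof -
    have "(\<Sum>l=1..N. B i l * Vmat N l j) - (if i = j then 1 else 0) = 0"
    proof (rule Vmat_inj[OF N _ i, where c = "\<lambda>k. (\<Sum>l=1..N. B k l * Vmat N l j) - (if k = j then 1 else 0)"])
      fix i assume i: "i \<in> {1..N}"
      have "(\<Sum>k=1..N. Vmat N i k * (\<Sum>l=1..N. B k l * Vmat N l j))
          = (\<Sum>l=1..N. (\<Sum>k=1..N. Vmat N i k * B k l) * Vmat N l j)"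
        unfolding sum_distrib_left sum_distrib_right by (subst sum.swap) (simp add: mult.assoc)
      also have "\<dots> = (\<Sum>l=1..N. (if i = l then 1 else 0) * Vmat N l j)"
        using B i by (intro sum.cong) auto
      also have "\<dots> = Vmat N i j" using i by (simp add: if_distrib[where f="\<lambda>x. x * _"] cong: if_cong)
      finally show "(\<Sum>k=1..N. Vmat N i k * ((\<Sum>l=1..N. B k l * Vmat N l j) - (if k = j then 1 else 0))) = 0"
        using j by (simp add: right_diff_distrib sum_subtractf if_distrib[where f="\<lambda>x. _ * x"] cong: if_cong)
    qed
    then show ?thesis by simp
  qed
  have "inverse_of B" using B0 B BV by (auto simp: inverse_of_def)
  moreover have "B' = B" if B': "inverse_of B'" for B'
  proof (intro ext)
    fix k j
    show "B' k j = B k j"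
    proof (cases "k \<in> {1..N} \<and> j \<in> {1..N}")
      case True
      have "B' k j - B k j = 0"
        by (rule Vmat_inj[OF N, where c = "\<lambda>k. B' k j - B k j"])
          (use True B B' in \<open>auto simp: inverse_of_def right_diff_distrib sum_subtractf\<close>)
      then show ?thesis by simp
    qed (use B0 B' in \<open>auto simp: inverse_of_def\<close>)
  qed
  ultimately have "inverse_of (THE B. inverse_of B)" by (rule theI)
  then have "inverse_of (Vinv N)" unfolding Vinv_def inverse_of_def .
  then show ?thesis using ij unfolding inverse_of_def by blast
qed

section \<open>The one-dimensional scheme\<close>

text \<open>This is the integral of \<open>t ^ m\<close> over the \<open>i\<close>-th cell.\<close>

definition cell_moment :: "nat \<Rightarrow> nat \<Rightarrow> nat \<Rightarrow> real" where
  "cell_moment N i m = (node N i ^ Suc m - node N (i - 1) ^ Suc m) / real (Suc m)"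

definition kern :: "nat \<Rightarrow> real \<Rightarrow> nat \<Rightarrow> real" where
  "kern N t i = (\<Sum>b\<le>N - 1. real (b + 1) * Vinv N (b + 1) i * t ^ b)"

text \<open>The image of \<open>t\<^bsup>m\<^esup>\<close> under the one-dimensional scheme; \<open>kern N t i\<close> is the weight of the \<open>i\<close>-th cell
  integral in its value at \<open>t\<close>.\<close>
definition proj :: "nat \<Rightarrow> nat \<Rightarrow> real \<Rightarrow> real" where
  "proj N m t = (\<Sum>i=1..N. kern N t i * cell_moment N i m)"

text \<open>Applying \<open>Vinv\<close> to the cell moments yields the coefficients of a polynomial
  whose increments over the cells are these moments, so up to a constant it interpolates an
  antiderivative of \<open>t ^ m\<close>. The factor \<open>b + 1\<close> in \<open>kern\<close>
  then performs the differentiation.\<close>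

lemma proj_interpolant:
  assumes N: "1 \<le> N"
  shows "\<exists>Q. degree Q \<le> N \<and> (\<forall>i\<le>N. poly Q (node N i) = node N i ^ Suc m) \<and>
             (\<forall>t. poly (pderiv Q) t = real (Suc m) * proj N m t)"
proof -
  define e where "e j = (\<Sum>i=1..N. Vinv N j i * cell_moment N i m)" for j
  define P where "P = (\<Sum>j=1..N. Polynomial.monom (e j) j)"
  have coeff: "coeff P k = (if k \<in> {1..N} then e k else 0)" for k
    by (simp add: P_def coeff_sum)
  have deg: "degree P \<le> N" by (rule degree_le) (simp add: coeff)
  have step: "poly P (node N i) - poly P (node N (i - 1)) = cell_moment N i m" if i: "i \<in> {1..N}" for i
  proof -
    have "poly P (node N i) - poly P (node N (i - 1)) = (\<Sum>k=1..N. Vmat N i k * e k)"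
      using Vmat_mult_coeffs[OF i deg] by (simp add: coeff)
    also have "\<dots> = (\<Sum>l=1..N. (\<Sum>k=1..N. Vmat N i k * Vinv N k l) * cell_moment N l m)"
      unfolding e_def sum_distrib_left sum_distrib_right by (subst sum.swap) (simp add: mult.assoc)
    also have "\<dots> = (\<Sum>l=1..N. (if i = l then 1 else 0) * cell_moment N l m)"
      using Vmat_Vinv[OF N] i by (intro sum.cong) auto
    also have "\<dots> = cell_moment N i m" using i by (simp add: if_distrib[where f="\<lambda>x. x * _"] cong: if_cong)
    finally show ?thesis .
  qed
  \<comment> \<open>The constant fixes the value at node 0, which is -1; the increments carry the
    agreement to the other nodes.\<close>
  define Q where "Q = smult (real (Suc m)) P + [:(-1) ^ Suc m - real (Suc m) * poly P (-1):]"
  have "poly Q (node N i) = node N i ^ Suc m" if "i \<le> N" for i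
    using that
  proof (induction i)
    case (Suc i)
    have "real (Suc m) * (poly P (node N (Suc i)) - poly P (node N i)) = node N (Suc i) ^ Suc m - node N i ^ Suc m"
      using step[of "Suc i"] Suc.prems by (simp add: cell_moment_def)
    then show ?case using Suc by (simp add: Q_def algebra_simps)
  qed (simp add: Q_def)
  moreover have "degree Q \<le> N"
    unfolding Q_def using deg by (intro degree_add_le) (auto intro: order_trans[OF degree_smult_le])
  moreover have "poly (pderiv Q) t = real (Suc m) * proj N m t" for t
  proof -
    have "poly (pderiv P) t = (\<Sum>j=1..N. real j * e j * t ^ (j - 1))"
      by (simp add: P_def higher_pderiv_sum[of 1, simplified] poly_sum pderiv_monom poly_monom mult.commute)
    also have "\<dots> = (\<Sum>b\<le>N - 1. real (b + 1) * e (b + 1) * t ^ b)"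
      using N by (intro sum.reindex_bij_witness[of _ "\<lambda>b. b + 1" "\<lambda>j. j - 1"]) auto
    also have "\<dots> = proj N m t"
      unfolding proj_def kern_def e_def sum_distrib_left sum_distrib_right
      by (subst sum.swap) (simp add: mult_ac)
    finally show ?thesis by (simp add: Q_def pderiv_add pderiv_smult pderiv_pCons)
  qed
  ultimately show ?thesis by blast
qed

lemma proj_eq_power:
  assumes "m < N"
  shows "proj N m t = t ^ m"
proof -
  have N: "1 \<le> N" using assms by simp
  obtain Q where Q: "degree Q \<le> N" "\<And>i. i \<le> N \<Longrightarrow> poly Q (node N i) = node N i ^ Suc m"
    "poly (pderiv Q) t = real (Suc m) * proj N m t"
    using proj_interpolant[OF N] by blast
  have "Q = Polynomial.monom 1 (Suc m)"
    using Q assms card_nodes[OF N] by (intro poly_eqI_degree[of "nodes N"]) (auto simp: poly_monom degree_monom_eq)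
  then have "real (Suc m) * proj N m t = real (Suc m) * t ^ m"
    using Q(3) by (simp add: pderiv_monom poly_monom)
  then show ?thesis by (simp del: of_nat_Suc)
qed

lemma proj_bound:
  assumes N: "1 \<le> N" and R: "1 < R" and t: "\<bar>t\<bar> \<le> 1"
  shows "\<bar>proj N m t\<bar> \<le> (1 + 3 * R / (R - 1)) * R ^ m"
proof -
  have tm: "\<bar>t ^ m\<bar> \<le> R ^ m"
    using t R by (simp add: power_abs power_mono)
  have "\<bar>t ^ m - proj N m t\<bar> \<le> 3 * R / (R - 1) * R ^ m"
  proof (cases "m < N")
    case True
    then show ?thesis using R by (simp add: proj_eq_power)
  next
    case False
    obtain Q where Q: "degree Q \<le> N" "\<And>i. i \<le> N \<Longrightarrow> poly Q (node N i) = node N i ^ Suc m"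
      "poly (pderiv Q) t = real (Suc m) * proj N m t"
      using proj_interpolant[OF N] by blast
    have "\<bar>real (Suc m) * t ^ m - poly (pderiv Q) t\<bar> \<le> real (Suc m) * (3 * R ^ Suc m / (R - 1))"
      using power_interpolant_deriv_error[OF N _ R t Q(1,2)] False by fastforce
    \<comment> \<open>The degree factor in the error bound cancels against the one from integrating
      \<open>t ^ m\<close>, so the constant is free of \<open>m\<close> and
      \<open>N\<close>.\<close>
    then have "real (Suc m) * \<bar>t ^ m - proj N m t\<bar> \<le> real (Suc m) * (3 * R ^ Suc m / (R - 1))"
      unfolding Q(3) right_diff_distrib[symmetric] by (simp add: abs_mult del: of_nat_Suc)
    then have "\<bar>t ^ m - proj N m t\<bar> \<le> 3 * R ^ Suc m / (R - 1)"
      by (rule mult_left_le_imp_le) simp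
    then show ?thesis by simp
  qed
  then have "\<bar>proj N m t\<bar> \<le> R ^ m + 3 * R / (R - 1) * R ^ m"
    using tm by linarith
  then show ?thesis unfolding distrib_right by simp
qed

subsection \<open>Cell integrals\<close>

text \<open>Lebesgue measure is the image of the product measure indexed by \<open>Basis\<close>;
  \<open>idx\<close> translates a basis vector \<open>axis k 1\<close> back to its coordinate
  \<open>k\<close>, after which Fubini for finite products applies.\<close>

lemma lborel_integral_prod_components:
  fixes F :: "'n::finite \<Rightarrow> real \<Rightarrow> real"
  assumes F: "\<And>k. integrable lborel (F k)"
  shows "(\<integral>x. (\<Prod>k\<in>UNIV. F k (x $ k)) \<partial>(lborel :: (real^'n) measure)) = (\<Prod>k\<in>UNIV. integral\<^sup>L lborel (F k))"
proof -
  interpret product_sigma_finite "\<lambda>_::real^'n. lborel :: real measure" ..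
  define idx :: "real^'n \<Rightarrow> 'n" where "idx = inv (\<lambda>k. axis k 1)"
  have inj: "inj (\<lambda>k::'n. axis k (1::real))"
    by (auto intro!: injI simp: axis_eq_axis)
  have idx [simp]: "idx (axis k 1) = k" for k
    unfolding idx_def by (rule inv_f_f[OF inj])
  have Basis: "(Basis :: (real^'n) set) = range (\<lambda>k. axis k 1)"
    by (auto simp: Basis_vec_def)
  have prod_Basis: "(\<Prod>b\<in>(Basis :: (real^'n) set). h b) = (\<Prod>k\<in>UNIV. h (axis k 1))" for h :: "real^'n \<Rightarrow> real"
    unfolding Basis by (subst prod.reindex[OF inj]) simp
  have component: "(\<Sum>b\<in>Basis. f b *\<^sub>R b) $ k = f (axis k 1)" for f :: "real^'n \<Rightarrow> real" and k
  proof -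
    have "(\<Sum>b\<in>Basis. f b *\<^sub>R b) $ k = (\<Sum>b\<in>Basis. f b *\<^sub>R b) \<bullet> axis k 1"
      by (simp add: inner_axis)
    also have "\<dots> = f (axis k 1)"
      by (rule inner_sum_left_Basis) (auto simp: Basis)
    finally show ?thesis .
  qed
  have [measurable]: "F k \<in> borel_measurable borel" for k
    using borel_measurable_integrable[OF F[of k]] by simp
  have "(\<integral>x. (\<Prod>k\<in>UNIV. F k (x $ k)) \<partial>(lborel :: (real^'n) measure))
      = (\<integral>f. (\<Prod>k\<in>UNIV. F k (f (axis k 1))) \<partial>(\<Pi>\<^sub>M b\<in>(Basis :: (real^'n) set). lborel))"
    unfolding component[symmetric] by (subst lborel_eq, subst integral_distr) auto
  also have "\<dots> = (\<integral>f. (\<Prod>b\<in>Basis. F (idx b) (f b)) \<partial>(\<Pi>\<^sub>M b\<in>(Basis :: (real^'n) set). lborel))"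
    unfolding prod_Basis by simp
  also have "\<dots> = (\<Prod>b\<in>(Basis :: (real^'n) set). integral\<^sup>L lborel (F (idx b)))"
    by (rule product_integral_prod) (auto intro: F)
  finally show ?thesis unfolding prod_Basis by simp
qed

lemma cbox_vec: "cbox (\<chi> k. l k) (\<chi> k. u k) = {x :: real^'n. \<forall>k. l k \<le> x $ k \<and> x $ k \<le> u k}"
  by (auto simp: mem_box_cart)

lemma continuous_on_monom: "continuous_on S (Defs.monom \<beta>)"
  unfolding Defs.monom_def by (intro continuous_intros)

lemma integral_monom_cbox:
  fixes l u :: "'n::finite \<Rightarrow> real"
  assumes "\<And>k. l k \<le> u k"
  shows "(\<integral>x\<in>cbox (\<chi> k. l k) (\<chi> k. u k). Defs.monom \<beta> x \<partial>lborel)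
       = (\<Prod>k\<in>UNIV. (u k ^ Suc (\<beta> k) - l k ^ Suc (\<beta> k)) / real (Suc (\<beta> k)))"
proof -
  have *: "indicator (cbox (\<chi> k. l k) (\<chi> k. u k)) x = (\<Prod>k\<in>UNIV. indicator {l k..u k} (x $ k) :: real)"
    for x :: "real^'n"
    by (auto simp: cbox_vec indicator_def prod_zero_iff split: if_splits)
  have "(\<integral>x\<in>cbox (\<chi> k. l k) (\<chi> k. u k). Defs.monom \<beta> x \<partial>lborel)
      = (\<integral>x. (\<Prod>k\<in>UNIV. (x $ k) ^ \<beta> k * indicator {l k..u k} (x $ k)) \<partial>(lborel :: (real^'n) measure))"
    unfolding set_lebesgue_integral_def Defs.monom_def * by (simp add: prod.distrib mult.commute)
  also have "\<dots> = (\<Prod>k\<in>UNIV. (\<integral>t. t ^ \<beta> k * indicator {l k..u k} t \<partial>lborel))"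
  proof (rule lborel_integral_prod_components)
    fix k
    have "integrable lborel (\<lambda>t. indicator {l k..u k} t *\<^sub>R t ^ \<beta> k)"
      by (intro borel_integrable_compact continuous_intros) auto
    then show "integrable lborel (\<lambda>t. t ^ \<beta> k * indicator {l k..u k} t)"
      by (simp add: mult.commute)
  qed
  also have "\<dots> = (\<Prod>k\<in>UNIV. (u k ^ Suc (\<beta> k) - l k ^ Suc (\<beta> k)) / real (Suc (\<beta> k)))"
    by (intro prod.cong refl integral_power assms)
  finally show ?thesis .
qed

abbreviation multi_indices :: "nat \<Rightarrow> ('n \<Rightarrow> nat) set" where
  "multi_indices N \<equiv> {\<alpha>. \<forall>k. 1 \<le> \<alpha> k \<and> \<alpha> k \<le> N}"

lemma Rcell_cbox:
  assumes "\<And>k. 1 \<le> \<alpha> k"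
  shows "Rcell N \<alpha> = cbox (\<chi> k. node N (\<alpha> k - 1)) (\<chi> k. node N (\<alpha> k))"
  using assms by (simp add: Rcell_def cbox_vec node_def of_nat_diff)

lemma cube_cbox: "cube r = cbox (\<chi> k. - r) (\<chi> k. r)"
  by (simp add: cube_def cbox_vec)

lemma Rcell_subset_cube:
  assumes N: "1 \<le> N" and \<alpha>: "\<alpha> \<in> multi_indices N"
  shows "Rcell N \<alpha> \<subseteq> cube 1"
proof
  fix x :: "real^'a" assume x: "x \<in> Rcell N \<alpha>"
  have "- 1 \<le> x $ k \<and> x $ k \<le> 1" for k
  proof -
    have "node N (\<alpha> k - 1) \<le> x $ k" "x $ k \<le> node N (\<alpha> k)"
      using x \<alpha> by (auto simp: Rcell_cbox cbox_vec)
    moreover have "node N (\<alpha> k - 1) \<in> {-1..1}" "node N (\<alpha> k) \<in> {-1..1}"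
      using \<alpha> by (intro node_bounds[OF N]; auto intro: order_trans[OF diff_le_self])+
    ultimately show ?thesis by auto
  qed
  then show "x \<in> cube 1" by (simp add: cube_def)
qed

lemma integral_monom_Rcell:
  assumes N: "1 \<le> N" and \<alpha>: "\<alpha> \<in> multi_indices N"
  shows "(\<integral>x\<in>Rcell N \<alpha>. Defs.monom \<beta> x \<partial>lborel) = (\<Prod>k\<in>UNIV. cell_moment N (\<alpha> k) (\<beta> k))"
  using \<alpha> unfolding cell_moment_def
  by (subst Rcell_cbox, simp, subst integral_monom_cbox) (auto simp: node_le_iff[OF N])

section \<open>The sign change of f and the coefficients \<open>dcoef\<close>\<close>

lemma continuous_sgnp_nonzero:
  assumes "continuous_on I h" "y \<in> I" "h y \<noteq> 0"
  shows "continuous (at y within I) (\<lambda>t. sgnp (h t))"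
proof -
  have lim: "(h \<longlongrightarrow> h y) (at y within I)"
    using assms by (simp add: continuous_on_def)
  have "\<forall>\<^sub>F t in at y within I. sgnp (h t) = sgnp (h y)"
  proof (cases "h y > 0")
    case True
    then show ?thesis
      using order_tendstoD(1)[OF lim True] by (auto simp: sgnp_def elim!: eventually_mono)
  next
    case False
    then have "h y < 0" using assms by simp
    then show ?thesis
      using order_tendstoD(2)[OF lim, of 0] by (auto simp: sgnp_def not_le elim!: eventually_mono)
  qed
  then show ?thesis by (simp add: continuous_within tendsto_eventually)
qed

text \<open>The sign is locally constant off the zeros, so the jump sits at \<open>c\<close>. Since
  \<open>sgnp 0 = 1\<close>, monotonicity settles the side of \<open>c\<close> where
  \<open>h\<close> is nonnegative. A nonnegative value on the other side would spread by
  monotonicity to a neighbourhood of \<open>c\<close> and remove the jump.\<close>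

lemma sign_change:
  fixes h :: "real \<Rightarrow> real"
  assumes cont: "continuous_on I h"
    and jump: "\<exists>!y. y \<in> I \<and> \<not> continuous (at y within I) (\<lambda>t. sgnp (h t))"
    and c: "c \<in> I" "h c = 0" and unique: "\<And>y. y \<in> I \<Longrightarrow> h y = 0 \<Longrightarrow> y = c"
  shows "mono_on I (\<lambda>y. sgnp (h y)) \<Longrightarrow> y \<in> I \<Longrightarrow> 0 \<le> h y \<longleftrightarrow> c \<le> y" (is "?mono \<Longrightarrow> _ \<Longrightarrow> _")
    and "antimono_on I (\<lambda>y. sgnp (h y)) \<Longrightarrow> y \<in> I \<Longrightarrow> 0 \<le> h y \<longleftrightarrow> y \<le> c" (is "?anti \<Longrightarrow> _ \<Longrightarrow> _")
proof -
  have c_jump: "\<not> continuous (at c within I) (\<lambda>t. sgnp (h t))"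
    using jump continuous_sgnp_nonzero[OF cont] unique by metis
  have not_const: False if "open U" "c \<in> U" "\<And>t. t \<in> U \<Longrightarrow> t \<in> I \<Longrightarrow> 0 \<le> h t" for U
  proof -
    have "\<forall>\<^sub>F t in at c within I. sgnp (h t) = sgnp (h c)"
      unfolding eventually_at_topological using that c by (intro exI[of _ U]) (auto simp: sgnp_def)
    then show False using c_jump by (simp add: continuous_within tendsto_eventually)
  qed
  show "0 \<le> h y \<longleftrightarrow> c \<le> y" if m: ?mono and y: "y \<in> I"
  proof
    assume "c \<le> y"
    then have "sgnp (h c) \<le> sgnp (h y)" using m y c(1) by (auto simp: monotone_on_def)
    then show "0 \<le> h y" using c by (simp add: sgnp_def split: if_splits)
  next
    assume hy: "0 \<le> h y"
    show "c \<le> y"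
    proof (rule ccontr)
      assume "\<not> c \<le> y"
      moreover have "0 \<le> h t" if "t \<in> {y<..}" "t \<in> I" for t
      proof -
        have "sgnp (h y) \<le> sgnp (h t)" using m y that by (auto simp: monotone_on_def)
        then show ?thesis using hy by (simp add: sgnp_def split: if_splits)
      qed
      ultimately show False using not_const[of "{y<..}"] by auto
    qed
  qed
  show "0 \<le> h y \<longleftrightarrow> y \<le> c" if m: ?anti and y: "y \<in> I"
  proof
    assume "y \<le> c"
    then have "sgnp (h c) \<le> sgnp (h y)" using m y c(1) by (auto simp: monotone_on_def)
    then show "0 \<le> h y" using c by (simp add: sgnp_def split: if_splits)
  next
    assume hy: "0 \<le> h y"
    show "y \<le> c"
    proof (rule ccontr)
      assume "\<not> y \<le> c"
      moreover have "0 \<le> h t" if "t \<in> {..<y}" "t \<in> I" for t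
      proof -
        have "sgnp (h y) \<le> sgnp (h t)" using m y that by (auto simp: monotone_on_def)
        then show ?thesis using hy by (simp add: sgnp_def split: if_splits)
      qed
      ultimately show False using not_const[of "{..<y}"] by auto
    qed
  qed
qed

text \<open>The superlevel set is compact, so its indicator is integrable and Fubini applies to
  it.\<close>

lemma set_integral_heav_superlevel:
  fixes f :: "real^'n \<Rightarrow> real \<Rightarrow> real"
  assumes K: "compact K" and f: "continuous_on (K \<times> {a..b}) (\<lambda>z. f (fst z) (snd z))"
  shows "(\<integral>z\<in>K \<times> {a..b}. heav (f (fst z) (snd z)) \<partial>lborel)
       = (\<integral>x\<in>K. measure lborel {y \<in> {a..b}. 0 \<le> f x y} \<partial>lborel)"
proof -
  define S where "S = {z \<in> K \<times> {a..b}. 0 \<le> f (fst z) (snd z)}"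
  have KI: "compact (K \<times> {a..b})" using K by (intro compact_Times) auto
  have S_eq: "S = (K \<times> {a..b}) \<inter> (\<lambda>z. f (fst z) (snd z)) -` {0..}"
    by (auto simp: S_def)
  have "closed S"
    unfolding S_eq using f compact_imp_closed[OF KI] by (intro continuous_closed_preimage) auto
  moreover have "bounded S"
    using compact_imp_bounded[OF KI] by (rule bounded_subset) (auto simp: S_def)
  ultimately have S: "compact S" by (simp add: compact_eq_bounded_closed)
  have int: "integrable (lborel \<Otimes>\<^sub>M lborel) (indicator S :: _ \<Rightarrow> real)"
    unfolding lborel_prod using borel_integrable_compact[OF S, of "\<lambda>_. 1::real"] by simp
  have "(\<integral>z\<in>K \<times> {a..b}. heav (f (fst z) (snd z)) \<partial>lborel) = (\<integral>z. indicator S z \<partial>lborel)"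
    unfolding set_lebesgue_integral_def
    by (intro Bochner_Integration.integral_cong) (auto simp: S_def heav_def indicator_def)
  also have "\<dots> = (\<integral>x. (\<integral>y. indicator S (x, y) \<partial>lborel) \<partial>lborel)"
    using lborel_pair.integral_fst'[OF int] by (simp add: lborel_prod)
  also have "\<dots> = (\<integral>x\<in>K. measure lborel {y \<in> {a..b}. 0 \<le> f x y} \<partial>lborel)"
    unfolding set_lebesgue_integral_def
  proof (intro Bochner_Integration.integral_cong refl)
    fix x
    have "(\<lambda>y. indicator S (x, y)) = (\<lambda>y. indicator K x * indicator {y \<in> {a..b}. 0 \<le> f x y} y :: real)"
      by (auto simp: S_def indicator_def)
    then show "(\<integral>y. indicator S (x, y) \<partial>lborel) = indicator K x *\<^sub>R measure lborel {y \<in> {a..b}. 0 \<le> f x y}"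
      by simp
  qed
  finally show ?thesis .
qed

text \<open>The slice where \<open>f x\<close> is nonnegative is \<open>{g x..b}\<close> or
  \<open>{a..g x}\<close>, of length \<open>b - g x\<close> or \<open>g x - a\<close>; the end point
  terms and the sign \<open>ny\<close> in \<open>dcoef\<close> turn this length back into
  \<open>g x\<close>.\<close>

lemma dcoef_eq_integral:
  fixes f :: "real^'n \<Rightarrow> real \<Rightarrow> real"
  assumes f_cont: "continuous_on (cube 1 \<times> {a..b}) (\<lambda>z. f (fst z) (snd z))"
    and A1: "assumption1 f {a..b}"
    and ny: "(ny = 1 \<and> (\<forall>x\<in>cube 1. mono_on {a..b} (\<lambda>y. sgnp (f x y))))
           \<or> (ny = -1 \<and> (\<forall>x\<in>cube 1. antimono_on {a..b} (\<lambda>y. sgnp (f x y))))"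
    and g_impl: "\<forall>x\<in>cube 1. g x \<in> {a..b} \<and> f x (g x) = 0"
    and g_unique: "\<forall>x\<in>cube 1. \<forall>y\<in>{a..b}. f x y = 0 \<longrightarrow> y = g x"
    and g_cont: "continuous_on (cube 1) g"
    and N: "1 \<le> N" and \<alpha>: "\<alpha> \<in> multi_indices N"
  shows "dcoef f a b ny N \<alpha> = (\<integral>x\<in>Rcell N \<alpha>. g x \<partial>lborel)"
proof -
  define K where "K = Rcell N \<alpha>"
  have K: "compact K" "K \<subseteq> cube 1"
    using Rcell_subset_cube[OF N \<alpha>] \<alpha> by (auto simp: K_def Rcell_cbox)
  have K_sets: "K \<in> sets lborel" using K by (simp add: borel_compact)
  have slice: "continuous_on {a..b} (f x)" if "x \<in> cube 1" for x
  proof -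
    have "continuous_on {a..b} (\<lambda>y. (x, y))" by (intro continuous_intros)
    then have "continuous_on {a..b} (\<lambda>y. f (fst (x, y)) (snd (x, y)))"
      by (rule continuous_on_compose2[OF f_cont]) (use that in auto)
    then show ?thesis by simp
  qed
  have jump: "\<exists>!y. y \<in> {a..b} \<and> \<not> continuous (at y within {a..b}) (\<lambda>t. sgnp (f x t))"
    and zero: "g x \<in> {a..b}" "f x (g x) = 0" "\<And>y. y \<in> {a..b} \<Longrightarrow> f x y = 0 \<Longrightarrow> y = g x"
    if "x \<in> cube 1" for x
    using A1 g_impl g_unique that unfolding assumption1_def by blast+
  note sc = sign_change[OF slice jump zero]
  have g_int: "set_integrable lborel K g"
    unfolding set_integrable_def using g_cont K
    by (intro borel_integrable_compact) (auto intro: continuous_on_subset)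
  have c_int: "set_integrable lborel K (\<lambda>_. c)" for c :: real
    unfolding set_integrable_def using K by (intro borel_integrable_compact) auto
  have c_val: "(\<integral>x\<in>K. c \<partial>lborel) = measure lborel K * c" for c :: real
    by (simp add: set_lebesgue_integral_def)
  have heav: "(\<integral>z\<in>K \<times> {a..b}. heav (f (fst z) (snd z)) \<partial>lborel)
       = (\<integral>x\<in>K. measure lborel {y \<in> {a..b}. 0 \<le> f x y} \<partial>lborel)"
    using K f_cont by (intro set_integral_heav_superlevel continuous_on_subset[OF f_cont]) auto
  from ny show ?thesis
  proof (elim disjE conjE)
    assume ny1: "ny = 1" and m: "\<forall>x\<in>cube 1. mono_on {a..b} (\<lambda>y. sgnp (f x y))"
    have "measure lborel {y \<in> {a..b}. 0 \<le> f x y} = b - g x" if "x \<in> K" for x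
    proof -
      have x: "x \<in> cube 1" using that K by blast
      have "{y \<in> {a..b}. 0 \<le> f x y} = {g x..b}"
        using sc(1)[OF x x x x x] m zero(1)[OF x] x by auto
      then show ?thesis using g_impl x by simp
    qed
    then have "(\<integral>x\<in>K. measure lborel {y \<in> {a..b}. 0 \<le> f x y} \<partial>lborel) = (\<integral>x\<in>K. b - g x \<partial>lborel)"
      using K_sets by (intro set_lebesgue_integral_cong) auto
    also have "\<dots> = measure lborel K * b - (\<integral>x\<in>K. g x \<partial>lborel)"
      using set_integral_diff(2)[OF c_int g_int] by (simp add: c_val)
    finally show ?thesis unfolding dcoef_def K_def[symmetric] heav ny1 by simp
  next
    assume ny1: "ny = -1" and m: "\<forall>x\<in>cube 1. antimono_on {a..b} (\<lambda>y. sgnp (f x y))"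
    have "measure lborel {y \<in> {a..b}. 0 \<le> f x y} = g x - a" if "x \<in> K" for x
    proof -
      have x: "x \<in> cube 1" using that K by blast
      have "{y \<in> {a..b}. 0 \<le> f x y} = {a..g x}"
        using sc(2)[OF x x x x x] m zero(1)[OF x] x by auto
      then show ?thesis using g_impl x by simp
    qed
    then have "(\<integral>x\<in>K. measure lborel {y \<in> {a..b}. 0 \<le> f x y} \<partial>lborel) = (\<integral>x\<in>K. g x - a \<partial>lborel)"
      using K_sets by (intro set_lebesgue_integral_cong) auto
    also have "\<dots> = (\<integral>x\<in>K. g x \<partial>lborel) - measure lborel K * a"
      using set_integral_diff(2)[OF g_int c_int] by (simp add: c_val)
    finally show ?thesis unfolding dcoef_def K_def[symmetric] heav ny1 by simp
  qed
qed

section \<open>Series for the approximants\<close>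

text \<open>Tannery's theorem: by the M-test the finite partial sums converge uniformly in
  \<open>n\<close>, so the two limits may be interchanged.\<close>

lemma has_sum_dominated_tendsto:
  fixes a :: "nat \<Rightarrow> 'i \<Rightarrow> real"
  assumes bound: "\<And>n i. \<bar>a n i\<bar> \<le> M i" and M: "M summable_on UNIV"
    and lim: "\<And>i. (\<lambda>n. a n i) \<longlonglongrightarrow> c i"
    and s: "\<And>n. (a n has_sum s n) UNIV" and t: "(c has_sum t) UNIV"
  shows "s \<longlonglongrightarrow> t"
proof (rule swap_uniform_limit')
  show "uniform_limit UNIV (\<lambda>F n. \<Sum>i\<in>F. a n i) s (finite_subsets_at_top UNIV)"
    by (rule Weierstrass_m_test_general'[OF _ _ M]) (use bound s in auto)
  show "\<forall>\<^sub>F F in finite_subsets_at_top UNIV. (\<lambda>n. \<Sum>i\<in>F. a n i) \<longlonglongrightarrow> (\<Sum>i\<in>F. c i)"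
    using lim by (intro always_eventually allI tendsto_sum) auto
  show "((\<lambda>F. \<Sum>i\<in>F. c i) \<longlongrightarrow> t) (finite_subsets_at_top UNIV)"
    using t by (simp add: has_sum_def)
qed auto

lemma has_sum_finite_sum:
  fixes h :: "'j \<Rightarrow> 'i \<Rightarrow> real"
  assumes "\<And>j. j \<in> J \<Longrightarrow> (h j has_sum s j) A"
  shows "((\<lambda>i. \<Sum>j\<in>J. h j i) has_sum (\<Sum>j\<in>J. s j)) A"
  using assms by (induction J rule: infinite_finite_induct) (auto intro: has_sum_add)

lemma prod_sum_multi_indices:
  fixes h :: "'n::finite \<Rightarrow> nat \<Rightarrow> real"
  assumes "\<And>k. finite (B k)"
  shows "(\<Prod>k\<in>UNIV. \<Sum>i\<in>B k. h k i) = (\<Sum>\<alpha>\<in>{\<alpha>. \<forall>k. \<alpha> k \<in> B k}. \<Prod>k\<in>UNIV. h k (\<alpha> k))"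
  using prod_sum_PiE[of "UNIV :: 'n set" B h] assms by (simp add: PiE_UNIV_domain Pi_def)

text \<open>Exchanging the sums over coefficients and cells exposes a weight that is a product over
  the coordinates, which reduces the analysis to one dimension.\<close>

lemma gtil_eq_kern:
  "gtil f a b ny N x = (\<Sum>\<alpha>\<in>multi_indices N. dcoef f a b ny N \<alpha> * (\<Prod>k\<in>UNIV. kern N (x $ k) (\<alpha> k)))"
proof -
  have "(\<Prod>k\<in>UNIV. kern N (x $ k) (\<alpha> k)) = (\<Sum>\<beta>\<in>{\<beta>. \<forall>k. \<beta> k \<le> N - 1}.
      \<Prod>k\<in>UNIV. real (\<beta> k + 1) * Vinv N (\<beta> k + 1) (\<alpha> k) * (x $ k) ^ \<beta> k)" for \<alpha>
    unfolding kern_def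
    using prod_sum_multi_indices[of "\<lambda>_. {..N - 1}" "\<lambda>k b. real (b + 1) * Vinv N (b + 1) (\<alpha> k) * (x $ k) ^ b"]
    by simp
  note kern_prod = this
  show ?thesis
    unfolding gtil_def ctil_def Defs.monom_def kern_prod sum_distrib_left sum_distrib_right
    by (subst sum.swap) (simp add: prod.distrib mult_ac)
qed

text \<open>Only finitely many cells occur, so the series of the cell data may be summed term by
  term; distributivity turns each term into a product of one-dimensional images.\<close>

lemma gtil_has_sum:
  assumes d: "\<And>\<alpha>. \<alpha> \<in> multi_indices N \<Longrightarrow>
      ((\<lambda>\<gamma>. pc \<gamma> * (\<Prod>k\<in>UNIV. cell_moment N (\<alpha> k) (\<gamma> k))) has_sum dcoef f a b ny N \<alpha>) UNIV"
  shows "((\<lambda>\<gamma>. pc \<gamma> * (\<Prod>k\<in>UNIV. proj N (\<gamma> k) (x $ k))) has_sum gtil f a b ny N x) UNIV"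
proof -
  have "((\<lambda>\<gamma>. \<Sum>\<alpha>\<in>multi_indices N. (pc \<gamma> * (\<Prod>k\<in>UNIV. cell_moment N (\<alpha> k) (\<gamma> k)))
          * (\<Prod>k\<in>UNIV. kern N (x $ k) (\<alpha> k))) has_sum gtil f a b ny N x) UNIV"
    unfolding gtil_eq_kern by (intro has_sum_finite_sum has_sum_cmult_left d)
  moreover have "(\<Sum>\<alpha>\<in>multi_indices N. (pc \<gamma> * (\<Prod>k\<in>UNIV. cell_moment N (\<alpha> k) (\<gamma> k)))
          * (\<Prod>k\<in>UNIV. kern N (x $ k) (\<alpha> k))) = pc \<gamma> * (\<Prod>k\<in>UNIV. proj N (\<gamma> k) (x $ k))" for \<gamma>
    unfolding proj_def
    using prod_sum_multi_indices[of "\<lambda>_. {1..N}" "\<lambda>k i. kern N (x $ k) i * cell_moment N i (\<gamma> k)"]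
    by (simp add: prod.distrib sum_distrib_left mult_ac)
  ultimately show ?thesis by simp
qed

section \<open>Weak-star convergence\<close>

theorem theorem4p2:
  fixes f :: "real^'n \<Rightarrow> real \<Rightarrow> real"
    and g :: "real^'n \<Rightarrow> real"
    and a b ny \<delta> :: real
    and pc :: "('n \<Rightarrow> nat) \<Rightarrow> real"
  assumes ab: "a < b"
    and f_cont: "continuous_on (cube 1 \<times> {a..b}) (\<lambda>z. f (fst z) (snd z))"
    and A1: "assumption1 f {a..b}"
    and ny: "(ny = 1 \<and> (\<forall>x\<in>cube 1. mono_on {a..b} (\<lambda>y. sgnp (f x y))))
           \<or> (ny = -1 \<and> (\<forall>x\<in>cube 1. antimono_on {a..b} (\<lambda>y. sgnp (f x y))))"
    and g_impl: "\<forall>x\<in>cube 1. g x \<in> {a..b} \<and> f x (g x) = 0"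
    and g_unique: "\<forall>x\<in>cube 1. \<forall>y\<in>{a..b}. f x y = 0 \<longrightarrow> y = g x"
    and \<delta>: "\<delta> > 0"
    and ps_conv: "\<forall>x\<in>cube (1 + \<delta>). (\<lambda>\<beta>. pc \<beta> * monom \<beta> x) summable_on UNIV"
    and ps_g: "\<forall>x\<in>cube 1. g x = (\<Sum>\<^sub>\<infinity>\<beta>. pc \<beta> * monom \<beta> x)"
  shows "\<forall>\<phi>. set_integrable lebesgue (cube 1) \<phi> \<longrightarrow>
           (\<lambda>N. \<integral>x\<in>cube 1. gtil f a b ny N x * \<phi> x \<partial>lebesgue)
             \<longlonglongrightarrow> (\<integral>x\<in>cube 1. g x * \<phi> x \<partial>lebesgue)"
proof (intro allI impI)
  fix \<phi> :: "real^'n \<Rightarrow> real"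
  assume \<phi>: "set_integrable lebesgue (cube 1) \<phi>"
  define R where "R = 1 + \<delta>"
  have R: "1 < R" using \<delta> by (simp add: R_def)
  define C where "C = 1 + 3 * R / (R - 1)"
  have C: "1 \<le> C" using R by (simp add: C_def)
  \<comment> \<open>The majorant consists of the absolute terms of the power series at the corner
    \<open>(R, ..., R)\<close> of the larger cube, where unordered summability of reals is
    absolute.\<close>
  define M where "M \<gamma> = \<bar>pc \<gamma>\<bar> * (\<Prod>k\<in>UNIV. R ^ \<gamma> k)" for \<gamma> :: "'n \<Rightarrow> nat"
  have M: "M summable_on UNIV"
  proof -
    have "(\<chi> k. R) \<in> cube (1 + \<delta>)" using R by (simp add: cube_def R_def)
    then have "(\<lambda>\<beta>. pc \<beta> * monom \<beta> (\<chi> k. R)) summable_on UNIV" using ps_conv by blast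
    then have "(\<lambda>\<beta>. norm (pc \<beta> * monom \<beta> (\<chi> k. R))) summable_on UNIV"
      by (rule iffD1[OF summable_on_iff_abs_summable_on_real])
    then show ?thesis
      using R by (simp add: M_def[abs_def] monom_def abs_mult abs_prod)
  qed
  have monom_le: "\<bar>pc \<gamma> * monom \<gamma> x\<bar> \<le> M \<gamma>" if "x \<in> cube 1" for \<gamma> x
  proof -
    have "\<bar>x $ k\<bar> \<le> R" for k
    proof -
      have "- 1 \<le> x $ k \<and> x $ k \<le> 1" using that by (simp add: cube_def)
      then show ?thesis using R by linarith
    qed
    then have "\<bar>x $ k ^ \<gamma> k\<bar> \<le> R ^ \<gamma> k" for k
      unfolding power_abs by (intro power_mono) auto
    then show ?thesis
      unfolding M_def monom_def abs_mult abs_prod by (intro mult_left_mono prod_mono) auto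
  qed
  have g_sum: "((\<lambda>\<gamma>. pc \<gamma> * monom \<gamma> x) has_sum g x) UNIV" if "x \<in> cube 1" for x
  proof -
    have "- (1 + \<delta>) \<le> x $ k \<and> x $ k \<le> 1 + \<delta>" if "- 1 \<le> x $ k \<and> x $ k \<le> 1" for k
      using that \<delta> by linarith
    then have "x \<in> cube (1 + \<delta>)" using that by (simp add: cube_def)
    then show ?thesis using ps_conv ps_g that by (simp add: has_sum_infsum)
  qed
  \<comment> \<open>Uniform convergence serves twice: it makes \<open>g\<close> continuous and
    allows integration term by term over the cells.\<close>
  have unif: "uniform_limit (cube 1) (\<lambda>F x. \<Sum>\<gamma>\<in>F. pc \<gamma> * monom \<gamma> x) g (finite_subsets_at_top UNIV)"
    by (rule Weierstrass_m_test_general'[OF _ g_sum M]) (use monom_le in auto)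
  have cont_partial: "continuous_on S (\<lambda>x. \<Sum>\<gamma>\<in>F. pc \<gamma> * monom \<gamma> x)" for S :: "(real^'n) set" and F
    by (intro continuous_intros continuous_on_monom)
  have g_cont: "continuous_on (cube 1) g"
    by (rule uniform_limit_theorem[OF _ unif]) (auto intro: cont_partial)
  have d: "((\<lambda>\<gamma>. pc \<gamma> * (\<Prod>k\<in>UNIV. cell_moment N (\<alpha> k) (\<gamma> k))) has_sum dcoef f a b ny N \<alpha>) UNIV"
    if N: "1 \<le> N" and \<alpha>: "\<alpha> \<in> multi_indices N" for N \<alpha>
  proof -
    define l u where "l = (\<chi> k. node N (\<alpha> k - 1))" and "u = (\<chi> k. node N (\<alpha> k))"
    have K: "Rcell N \<alpha> = cbox l u" using \<alpha> by (simp add: Rcell_cbox l_def u_def)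
    have sub: "cbox l u \<subseteq> cube 1" using Rcell_subset_cube[OF N \<alpha>] K by simp
    have int: "set_integrable lborel (cbox l u) h" if "continuous_on (cbox l u) h" for h :: "real^'n \<Rightarrow> real"
      unfolding set_integrable_def using that by (intro borel_integrable_compact) auto
    have has_int: "(h has_integral (\<integral>x\<in>cbox l u. h x \<partial>lborel)) (cbox l u)"
      if "continuous_on (cbox l u) h" for h :: "real^'n \<Rightarrow> real"
      using set_borel_integral_eq_integral[OF int[OF that]] by (simp add: integrable_integral)
    obtain I J where I: "\<And>F. ((\<lambda>x. \<Sum>\<gamma>\<in>F. pc \<gamma> * monom \<gamma> x) has_integral I F) (cbox l u)"
      and J: "(g has_integral J) (cbox l u)" and IJ: "(I \<longlongrightarrow> J) (finite_subsets_at_top UNIV)"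
      using uniform_limit_integral_cbox[OF uniform_limit_on_subset[OF unif sub] cont_partial]
        finite_subsets_at_top_neq_bot by blast
    have "J = (\<integral>x\<in>cbox l u. g x \<partial>lborel)"
      using has_integral_unique[OF J has_int] g_cont sub by (blast intro: continuous_on_subset)
    also have "\<dots> = dcoef f a b ny N \<alpha>"
      using dcoef_eq_integral[OF f_cont A1 ny g_impl g_unique g_cont N \<alpha>] K by simp
    finally have J_eq: "J = dcoef f a b ny N \<alpha>" .
    have I_eq: "I F = (\<Sum>\<gamma>\<in>F. pc \<gamma> * (\<Prod>k\<in>UNIV. cell_moment N (\<alpha> k) (\<gamma> k)))" for F
    proof (cases "finite F")
      case True
      have "((\<lambda>x. \<Sum>\<gamma>\<in>F. pc \<gamma> * monom \<gamma> x) has_integral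
          (\<Sum>\<gamma>\<in>F. pc \<gamma> * (\<integral>x\<in>cbox l u. monom \<gamma> x \<partial>lborel))) (cbox l u)"
        using True by (intro has_integral_sum has_integral_mult_right has_int continuous_on_monom)
      then show ?thesis
        using has_integral_unique[OF I] integral_monom_Rcell[OF N \<alpha>] K by simp
    next
      \<comment> \<open>A sum over an infinite \<open>F\<close> is 0 by convention, both in the
        integrand and in the claimed value.\<close>
      case False
      then show ?thesis using has_integral_unique[OF I[of F]] by simp
    qed
    show ?thesis using IJ unfolding J_eq has_sum_def by (simp add: I_eq[abs_def])
  qed
  define B where "B = C ^ CARD('n) * (\<Sum>\<^sub>\<infinity>\<gamma>. M \<gamma>)"
  \<comment> \<open>Each coordinate contributes one factor \<open>C\<close> from
    \<open>proj_bound\<close>.\<close>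
  have term_le: "\<bar>pc \<gamma> * (\<Prod>k\<in>UNIV. proj N (\<gamma> k) (x $ k))\<bar> \<le> C ^ CARD('n) * M \<gamma>"
    if "1 \<le> N" "x \<in> cube 1" for N x and \<gamma> :: "'n \<Rightarrow> nat"
  proof -
    have "(\<Prod>k\<in>UNIV. \<bar>proj N (\<gamma> k) (x $ k)\<bar>) \<le> (\<Prod>k\<in>UNIV. C * R ^ \<gamma> k)"
      using that unfolding C_def by (intro prod_mono conjI proj_bound R) (auto simp: cube_def abs_le_iff)
    then have "\<bar>pc \<gamma>\<bar> * (\<Prod>k\<in>UNIV. \<bar>proj N (\<gamma> k) (x $ k)\<bar>) \<le> \<bar>pc \<gamma>\<bar> * (\<Prod>k\<in>UNIV. C * R ^ \<gamma> k)"
      by (intro mult_left_mono) auto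
    then show ?thesis by (simp add: M_def abs_mult abs_prod prod.distrib mult_ac)
  qed
  have CM: "(\<lambda>\<gamma>. C ^ CARD('n) * M \<gamma>) summable_on UNIV"
    using M by (rule summable_on_cmult_right)
  have gtil_sum: "((\<lambda>\<gamma>. pc \<gamma> * (\<Prod>k\<in>UNIV. proj N (\<gamma> k) (x $ k))) has_sum gtil f a b ny N x) UNIV"
    if "1 \<le> N" for N x
    using d[OF that] by (rule gtil_has_sum)
  have gtil_le: "\<bar>gtil f a b ny N x\<bar> \<le> B" if N: "1 \<le> N" and x: "x \<in> cube 1" for N x
  proof -
    have B: "((\<lambda>\<gamma>. C ^ CARD('n) * M \<gamma>) has_sum B) UNIV"
      unfolding B_def using M by (intro has_sum_cmult_right) (simp add: has_sum_infsum)
    have "gtil f a b ny N x \<le> B"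
      using term_le[OF N x] by (intro has_sum_mono[OF gtil_sum[OF N] B]) (auto simp: abs_le_iff)
    moreover have "- gtil f a b ny N x \<le> B"
      using term_le[OF N x] gtil_sum[OF N, of x]
      by (intro has_sum_mono[OF _ B, of "\<lambda>\<gamma>. - (pc \<gamma> * (\<Prod>k\<in>UNIV. proj N (\<gamma> k) (x $ k)))"])
        (auto simp: abs_le_iff has_sum_uminus)
    ultimately show ?thesis by simp
  qed
  \<comment> \<open>The index \<open>Suc N\<close> keeps the number of cells positive. Each term is
    eventually constant in \<open>N\<close>, as soon as \<open>N\<close> is at least every one of
    the finitely many exponents in \<open>\<gamma>\<close>.\<close>
  have gtil_lim: "(\<lambda>N. gtil f a b ny (Suc N) x) \<longlonglongrightarrow> g x" if x: "x \<in> cube 1" for x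
  proof (rule has_sum_dominated_tendsto[OF _ CM _ gtil_sum g_sum[OF x]])
    show "(\<lambda>N. pc \<gamma> * (\<Prod>k\<in>UNIV. proj (Suc N) (\<gamma> k) (x $ k))) \<longlonglongrightarrow> pc \<gamma> * monom \<gamma> x" for \<gamma>
    proof (rule tendsto_eventually)
      have "\<forall>\<^sub>F N in sequentially. \<forall>k. \<gamma> k < Suc N"
        by (intro eventually_all_finite) (auto simp: eventually_sequentially less_Suc_eq_le)
      then show "\<forall>\<^sub>F N in sequentially.
          pc \<gamma> * (\<Prod>k\<in>UNIV. proj (Suc N) (\<gamma> k) (x $ k)) = pc \<gamma> * monom \<gamma> x"
        by eventually_elim (simp add: proj_eq_power monom_def)
    qed
  qed (use term_le x in auto)
  \<comment> \<open>Integrability on the cube says nothing about \<open>\<phi>\<close> outside it,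
    so measurability is available only for this truncation, and products are rewritten in terms of
    it.\<close>
  define w where "w x = indicator (cube 1) x *\<^sub>R \<phi> x" for x
  have w: "integrable lebesgue w" using \<phi> by (simp add: set_integrable_def w_def[abs_def])
  then have w_meas: "w \<in> borel_measurable lebesgue" by (rule borel_measurable_integrable)
  have cube: "cube 1 \<in> sets (borel :: (real^'n) measure)" unfolding cube_cbox by simp
  have meas: "(\<lambda>x. indicator (cube 1) x *\<^sub>R (h x * \<phi> x)) \<in> borel_measurable lebesgue"
    if "continuous_on (cube 1) h" for h
  proof -
    have "(\<lambda>x. indicator (cube 1) x *\<^sub>R h x) \<in> borel_measurable lborel"
      using borel_measurable_continuous_on_indicator[OF cube that] by simp
    then have hm: "(\<lambda>x. indicator (cube 1) x *\<^sub>R h x) \<in> borel_measurable lebesgue"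
      by (rule measurable_completion)
    have "(\<lambda>x. indicator (cube 1) x *\<^sub>R (h x * \<phi> x)) = (\<lambda>x. (indicator (cube 1) x *\<^sub>R h x) * w x)"
      by (auto simp: w_def indicator_def)
    then show ?thesis using borel_measurable_times[OF hm w_meas] by (simp only:)
  qed
  have "(\<lambda>N. \<integral>x\<in>cube 1. gtil f a b ny (Suc N) x * \<phi> x \<partial>lebesgue)
      \<longlonglongrightarrow> (\<integral>x\<in>cube 1. g x * \<phi> x \<partial>lebesgue)"
    unfolding set_lebesgue_integral_def
  \<comment> \<open>Boundedness by \<open>B\<close> and pointwise convergence on the cube give
    convergence against every integrable \<open>\<phi>\<close>.\<close>
  proof (rule integral_dominated_convergence[where w = "\<lambda>x. B * \<bar>w x\<bar>"])
    show "(\<lambda>x. indicator (cube 1) x *\<^sub>R (g x * \<phi> x)) \<in> borel_measurable lebesgue"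
      by (rule meas[OF g_cont])
    show "(\<lambda>x. indicator (cube 1) x *\<^sub>R (gtil f a b ny (Suc N) x * \<phi> x)) \<in> borel_measurable lebesgue" for N
      unfolding gtil_def by (intro meas continuous_intros continuous_on_monom)
    show "integrable lebesgue (\<lambda>x. B * \<bar>w x\<bar>)" using w by simp
    show "AE x in lebesgue. (\<lambda>N. indicator (cube 1) x *\<^sub>R (gtil f a b ny (Suc N) x * \<phi> x))
        \<longlonglongrightarrow> indicator (cube 1) x *\<^sub>R (g x * \<phi> x)"
      using gtil_lim by (auto simp: indicator_def intro!: tendsto_intros)
    show "AE x in lebesgue. norm (indicator (cube 1) x *\<^sub>R (gtil f a b ny (Suc N) x * \<phi> x)) \<le> B * \<bar>w x\<bar>" for N
      using gtil_le by (auto simp: w_def indicator_def abs_mult intro!: mult_right_mono)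
  qed
  then show "(\<lambda>N. \<integral>x\<in>cube 1. gtil f a b ny N x * \<phi> x \<partial>lebesgue)
      \<longlonglongrightarrow> (\<integral>x\<in>cube 1. g x * \<phi> x \<partial>lebesgue)"
    by (rule LIMSEQ_imp_Suc)
qed

end
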